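(* Let $(\phi,\mu,\vartheta)$ be regular functions on $\Omega\times(0,T)$ with $\vartheta>0$ that satisfy, for all smooth (periodic) test functions $\psi,\xi,\omega$ and all $t\in(0,T)$, the variational formulation $$\text{(V1)}\quad\langle\partial_t\phi,\psi\rangle=\Big\langle\tfrac{\mu}{\vartheta^2}\mathbf M\nabla\vartheta-\tfrac1\vartheta\mathbf M\nabla\mu-\tfrac1{\vartheta^2}\mathbf C\nabla\vartheta,\nabla\psi\Big\rangle,$$ $$\text{(V2)}\quad\langle\mu,\xi\rangle=\gamma\langle\nabla\phi,\vartheta\nabla\xi+\xi\nabla\vartheta\rangle+\langle\partial_\phi f(\phi,\vartheta),\xi\rangle,$$ $$\text{(V3)}\quad\langle\partial_t s,\omega\rangle=\Big\langle\tfrac1{\vartheta^2}\mathbf K\nabla\vartheta+\tfrac1\vartheta\mathbf C\nabla\mu-2\tfrac{\mu}{\vartheta^2}\mathbf C\nabla\vartheta-\tfrac\mu\vartheta\mathbf M\nabla\mu+\big(\tfrac\mu\vartheta\big)^2\mathbf M\nabla\vartheta,\ \tfrac{\omega}{\vartheta^2}\nabla\vartheta-\tfrac1\vartheta\nabla\omega\Big\rangle$$ $$\qquad+\Big\langle\tfrac1{\vartheta^2}\mathbf C\nabla\vartheta+\tfrac1\vartheta\mathbf M\nabla\mu-\tfrac{\mu}{\vartheta^2}\mathbf M\nabla\vartheta,\ \tfrac\omega\vartheta\nabla\mu\Big\rangle+\gamma\langle\partial_t\phi\,\nabla\phi,\nabla\omega\rangle .$$ Then for all $t\in(0,T)$ $$\langle\partial_t\phi,1\rangle=\langle\partial_t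 e,1\rangle=0,\qquad\langle\partial_t s,1\rangle=\mathcal D\big(\tfrac\mu\vartheta,\tfrac1\vartheta\big)\ge0 .$$ Moreover, these properties follow directly by using only the test functions $\psi\in\{1,\mu\}$ in (V1), $\xi=\partial_t\phi$ in (V2), and $\omega\in\{1,\vartheta\}$ in (V3).
   Context: $\Omega\subset\mathbb R^d$, $d\in\{1,2,3\}$, is a cube identified with the $d$-dimensional torus; all functions on $\Omega$ are periodic. $\langle u,v\rangle=\int_\Omega u\cdot v\,dx$. "Regular" means smooth enough (together with the coefficients) that all derivatives and integrations by parts are classical and $\mu,\partial_t\phi,\vartheta$ are admissible as test functions. Data: $\gamma>0$ is a constant. $f:\mathbb R\times\mathbb R_+\to\mathbb R$, $(\phi,\vartheta)\mapsto f(\phi,\vartheta)$, is smooth. $\mathbf M,\mathbf K,\mathbf C$ are $d\times d$-matrix-valued functions of $(\phi,\nabla\phi,\vartheta)$ such that the Onsager matrix $\mathbf L=\begin{pmatrix}\mathbf K&-\mathbf C\\-\mathbf C&\mathbf M\end{pmatrix}\in\mathbb R^{2d\times2d}$ satisfies $\lambda_0|\xi|^2\le\xi^\top\mathbf L\xi\le\lambda_1|\xi|^2$ for all $\xi\in\mathbb R^{2d}$, with constants $\lambda_0,\lambda_1>0$. Definitions: $s=s(\phi,\nabla\phi,\vartheta)=-\frac\gamma2|\nabla\phi|^2-\partial_\vartheta f(\phi,\vartheta)$ (entropy density), $e=e(\phi,\vartheta)=f(\phi,\vartheta)-\vartheta\,\partial_\vartheta f(\phi,\vartheta)$ (internal energy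 density), and $$\mathcal D\big(\tfrac\mu\vartheta,\tfrac1\vartheta\big)=\int_\Omega\begin{pmatrix}\nabla\frac1\vartheta\\ \nabla\frac\mu\vartheta\end{pmatrix}^{\!\top}\begin{pmatrix}\mathbf K&-\mathbf C\\-\mathbf C&\mathbf M\end{pmatrix}\begin{pmatrix}\nabla\frac1\vartheta\\ \nabla\frac\mu\vartheta\end{pmatrix}dx .$$ *)

theory Defs
  imports "HOL-Analysis.Analysis"
begin

section \<open>Classical smoothness\<close>

text \<open>
  Classes \<open>C\<^sup>k\<close> and \<open>C\<^sup>\<infinity>\<close> on an open subset \<open>S\<close> of a finite-dimensional space; \<open>S\<close> is always
  open below, so derivatives are taken at \<open>x\<close> without restriction to \<open>S\<close>.
\<close>

primrec Ck_on :: "nat \<Rightarrow> 'a set \<Rightarrow> ('a::euclidean_space \<Rightarrow> 'b::real_normed_vector) \<Rightarrow> bool" where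
  "Ck_on 0 S g \<longleftrightarrow> continuous_on S g"
| "Ck_on (Suc k) S g \<longleftrightarrow> (\<forall>x\<in>S. g differentiable at x) \<and>
     (\<forall>v. Ck_on k S (\<lambda>x. frechet_derivative g (at x) v))"

definition smooth_on :: "'a set \<Rightarrow> ('a::euclidean_space \<Rightarrow> 'b::real_normed_vector) \<Rightarrow> bool" where
  "smooth_on S g \<longleftrightarrow> (\<forall>k. Ck_on k S g)"

section \<open>Functions on the torus\<close>

text \<open>
  Functions on the torus obtained from a cube of side length \<open>l\<close> are functions on the whole space
  that are \<open>l\<close>-periodic in every coordinate; integration is over one period cell.
\<close>

definition cube :: "real^'d \<Rightarrow> real \<Rightarrow> (real^'d) set" where
  "cube a l = cbox a (a + (\<chi> i. l))"

definition periodic :: "real \<Rightarrow> (real^'d \<Rightarrow> 'b) \<Rightarrow> bool" where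
  "periodic l u \<longleftrightarrow> (\<forall>x i. u (x + axis i l) = u x)"

definition test_functions :: "real \<Rightarrow> (real^'d \<Rightarrow> real) set" where
  "test_functions l = {u. smooth_on UNIV u \<and> periodic l u}"

definition ip :: "(real^'d) set \<Rightarrow> (real^'d \<Rightarrow> 'b::real_inner) \<Rightarrow> (real^'d \<Rightarrow> 'b) \<Rightarrow> real" where
  "ip \<Omega> u v = integral \<Omega> (\<lambda>x. u x \<bullet> v x)"

definition grad :: "(real^'d \<Rightarrow> real) \<Rightarrow> real^'d \<Rightarrow> real^'d" where
  "grad u x = (\<chi> i. frechet_derivative u (at x) (axis i 1))"

text \<open>Space-time functions take the time first, so that \<open>u t\<close> is the spatial profile at time \<open>t\<close>.\<close>

definition dt :: "(real \<Rightarrow> real^'d \<Rightarrow> real) \<Rightarrow> real \<Rightarrow> real^'d \<Rightarrow> real" where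
  "dt u t x = deriv (\<lambda>\<tau>. u \<tau> x) t"

section \<open>Thermodynamic quantities\<close>

definition d\<phi> :: "(real \<Rightarrow> real \<Rightarrow> real) \<Rightarrow> real \<Rightarrow> real \<Rightarrow> real" where
  "d\<phi> f p r = deriv (\<lambda>p'. f p' r) p"

definition d\<theta> :: "(real \<Rightarrow> real \<Rightarrow> real) \<Rightarrow> real \<Rightarrow> real \<Rightarrow> real" where
  "d\<theta> f p r = deriv (\<lambda>r'. f p r') r"

definition entropy ::
  "real \<Rightarrow> (real \<Rightarrow> real \<Rightarrow> real) \<Rightarrow> (real \<Rightarrow> real^'d \<Rightarrow> real) \<Rightarrow> (real \<Rightarrow> real^'d \<Rightarrow> real) \<Rightarrow>
    real \<Rightarrow> real^'d \<Rightarrow> real" where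
  "entropy \<gamma> f \<phi> \<theta> t x = - (\<gamma> / 2) * (norm (grad (\<phi> t) x))\<^sup>2 - d\<theta> f (\<phi> t x) (\<theta> t x)"

definition energy ::
  "(real \<Rightarrow> real \<Rightarrow> real) \<Rightarrow> (real \<Rightarrow> real^'d \<Rightarrow> real) \<Rightarrow> (real \<Rightarrow> real^'d \<Rightarrow> real) \<Rightarrow>
    real \<Rightarrow> real^'d \<Rightarrow> real" where
  "energy f \<phi> \<theta> t x = f (\<phi> t x) (\<theta> t x) - \<theta> t x * d\<theta> f (\<phi> t x) (\<theta> t x)"

text \<open>A coefficient is a function of the values of \<open>(\<phi>, \<nabla>\<phi>, \<theta>)\<close>.\<close>

type_synonym 'd coeff = "real \<Rightarrow> real^'d \<Rightarrow> real \<Rightarrow> real^'d^'d"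

definition at_state ::
  "'d coeff \<Rightarrow> (real \<Rightarrow> real^'d \<Rightarrow> real) \<Rightarrow> (real \<Rightarrow> real^'d \<Rightarrow> real) \<Rightarrow>
    real \<Rightarrow> real^'d \<Rightarrow> real^'d^'d" where
  "at_state M \<phi> \<theta> t x = M (\<phi> t x) (grad (\<phi> t) x) (\<theta> t x)"

text \<open>
  The dimension \<open>2d\<close> is rendered by the index type \<open>'d + 'd\<close>. Both off-diagonal blocks of the
  Onsager matrix are \<open>- C\<close>; neither symmetry of \<open>C\<close> nor that of the whole matrix is imposed.
\<close>

definition onsager :: "real^'d^'d \<Rightarrow> real^'d^'d \<Rightarrow> real^'d^'d \<Rightarrow> real^('d + 'd)^('d + 'd)" where
  "onsager K C M = (\<chi> i j. case i of
       Inl i' \<Rightarrow> (case j of Inl j' \<Rightarrow> K $ i' $ j' | Inr j' \<Rightarrow> - (C $ i' $ j'))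
     | Inr i' \<Rightarrow> (case j of Inl j' \<Rightarrow> - (C $ i' $ j') | Inr j' \<Rightarrow> M $ i' $ j'))"

definition stack :: "real^'d \<Rightarrow> real^'d \<Rightarrow> real^('d + 'd)" where
  "stack u v = (\<chi> i. case i of Inl i' \<Rightarrow> u $ i' | Inr i' \<Rightarrow> v $ i')"

text \<open>
  \<open>dissipation \<Omega> L p q\<close> is \<open>D(p, q)\<close>, where \<open>L x\<close> is the Onsager matrix evaluated at the state
  at \<open>x\<close>. The gradient of the second argument is the upper block.
\<close>

definition dissipation ::
  "(real^'d) set \<Rightarrow> (real^'d \<Rightarrow> real^('d + 'd)^('d + 'd)) \<Rightarrow> (real^'d \<Rightarrow> real) \<Rightarrow> (real^'d \<Rightarrow> real) \<Rightarrow>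
    real" where
  "dissipation \<Omega> L p q =
     integral \<Omega> (\<lambda>x. stack (grad q x) (grad p x) \<bullet> (L x *v stack (grad q x) (grad p x)))"

section \<open>Regular functions and the variational formulation\<close>

text \<open>
  Joint regularity in \<open>(t, x)\<close> is only required as far as classical derivatives of \<open>\<phi>\<close> and \<open>\<theta>\<close>
  up to the order occurring in the equations demand it; the last three conditions are
  admissibility as test functions.
\<close>

definition regular ::
  "real \<Rightarrow> real \<Rightarrow> (real \<Rightarrow> real^'d \<Rightarrow> real) \<Rightarrow> (real \<Rightarrow> real^'d \<Rightarrow> real) \<Rightarrow> (real \<Rightarrow> real^'d \<Rightarrow> real) \<Rightarrow>
    bool" where
  "regular l T \<phi> \<mu> \<theta> \<longleftrightarrow>
     Ck_on 2 ({0<..<T} \<times> UNIV) (\<lambda>(t, x). \<phi> t x) \<and>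
     Ck_on 1 ({0<..<T} \<times> UNIV) (\<lambda>(t, x). \<theta> t x) \<and>
     (\<forall>t\<in>{0<..<T}. periodic l (\<phi> t) \<and>
        \<mu> t \<in> test_functions l \<and> dt \<phi> t \<in> test_functions l \<and> \<theta> t \<in> test_functions l)"

definition V1 ::
  "(real^'d) set \<Rightarrow> 'd coeff \<Rightarrow> 'd coeff \<Rightarrow>
   (real \<Rightarrow> real^'d \<Rightarrow> real) \<Rightarrow> (real \<Rightarrow> real^'d \<Rightarrow> real) \<Rightarrow> (real \<Rightarrow> real^'d \<Rightarrow> real) \<Rightarrow>
   real \<Rightarrow> (real^'d \<Rightarrow> real) \<Rightarrow> bool" where
  "V1 \<Omega> C M \<phi> \<mu> \<theta> t \<psi> \<longleftrightarrow>
     (let Ct = at_state C \<phi> \<theta> t; Mt = at_state M \<phi> \<theta> t in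
      ip \<Omega> (dt \<phi> t) \<psi> =
      ip \<Omega> (\<lambda>x. (\<mu> t x / (\<theta> t x)\<^sup>2) *\<^sub>R (Mt x *v grad (\<theta> t) x)
               - (1 / \<theta> t x) *\<^sub>R (Mt x *v grad (\<mu> t) x)
               - (1 / (\<theta> t x)\<^sup>2) *\<^sub>R (Ct x *v grad (\<theta> t) x))
           (grad \<psi>))"

definition V2 ::
  "(real^'d) set \<Rightarrow> real \<Rightarrow> (real \<Rightarrow> real \<Rightarrow> real) \<Rightarrow>
   (real \<Rightarrow> real^'d \<Rightarrow> real) \<Rightarrow> (real \<Rightarrow> real^'d \<Rightarrow> real) \<Rightarrow> (real \<Rightarrow> real^'d \<Rightarrow> real) \<Rightarrow>
   real \<Rightarrow> (real^'d \<Rightarrow> real) \<Rightarrow> bool" where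
  "V2 \<Omega> \<gamma> f \<phi> \<mu> \<theta> t \<xi> \<longleftrightarrow>
     ip \<Omega> (\<mu> t) \<xi> =
       \<gamma> * ip \<Omega> (grad (\<phi> t)) (\<lambda>x. \<theta> t x *\<^sub>R grad \<xi> x + \<xi> x *\<^sub>R grad (\<theta> t) x)
       + ip \<Omega> (\<lambda>x. d\<phi> f (\<phi> t x) (\<theta> t x)) \<xi>"

definition V3 ::
  "(real^'d) set \<Rightarrow> real \<Rightarrow> (real \<Rightarrow> real \<Rightarrow> real) \<Rightarrow> 'd coeff \<Rightarrow> 'd coeff \<Rightarrow> 'd coeff \<Rightarrow>
   (real \<Rightarrow> real^'d \<Rightarrow> real) \<Rightarrow> (real \<Rightarrow> real^'d \<Rightarrow> real) \<Rightarrow> (real \<Rightarrow> real^'d \<Rightarrow> real) \<Rightarrow>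
   real \<Rightarrow> (real^'d \<Rightarrow> real) \<Rightarrow> bool" where
  "V3 \<Omega> \<gamma> f K C M \<phi> \<mu> \<theta> t \<omega> \<longleftrightarrow>
     (let Kt = at_state K \<phi> \<theta> t; Ct = at_state C \<phi> \<theta> t; Mt = at_state M \<phi> \<theta> t in
      ip \<Omega> (dt (entropy \<gamma> f \<phi> \<theta>) t) \<omega> =
      ip \<Omega> (\<lambda>x. (1 / (\<theta> t x)\<^sup>2) *\<^sub>R (Kt x *v grad (\<theta> t) x)
               + (1 / \<theta> t x) *\<^sub>R (Ct x *v grad (\<mu> t) x)
               - (2 * (\<mu> t x / (\<theta> t x)\<^sup>2)) *\<^sub>R (Ct x *v grad (\<theta> t) x)
               - (\<mu> t x / \<theta> t x) *\<^sub>R (Mt x *v grad (\<mu> t) x)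
               + (\<mu> t x / \<theta> t x)\<^sup>2 *\<^sub>R (Mt x *v grad (\<theta> t) x))
           (\<lambda>x. (\<omega> x / (\<theta> t x)\<^sup>2) *\<^sub>R grad (\<theta> t) x - (1 / \<theta> t x) *\<^sub>R grad \<omega> x)
      + ip \<Omega> (\<lambda>x. (1 / (\<theta> t x)\<^sup>2) *\<^sub>R (Ct x *v grad (\<theta> t) x)
                 + (1 / \<theta> t x) *\<^sub>R (Mt x *v grad (\<mu> t) x)
                 - (\<mu> t x / (\<theta> t x)\<^sup>2) *\<^sub>R (Mt x *v grad (\<theta> t) x))
             (\<lambda>x. (\<omega> x / \<theta> t x) *\<^sub>R grad (\<mu> t) x)
      + \<gamma> * ip \<Omega> (\<lambda>x. dt \<phi> t x *\<^sub>R grad (\<phi> t) x) (grad \<omega>))"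

text \<open>The three identities at time \<open>t\<close>, tested with \<open>\<psi> \<in> \<Psi>\<close>, \<open>\<xi> \<in> \<Xi>\<close>, \<open>\<omega> \<in> W\<close> respectively.\<close>

definition variational ::
  "(real^'d) set \<Rightarrow> real \<Rightarrow> (real \<Rightarrow> real \<Rightarrow> real) \<Rightarrow> 'd coeff \<Rightarrow> 'd coeff \<Rightarrow> 'd coeff \<Rightarrow>
   (real \<Rightarrow> real^'d \<Rightarrow> real) \<Rightarrow> (real \<Rightarrow> real^'d \<Rightarrow> real) \<Rightarrow> (real \<Rightarrow> real^'d \<Rightarrow> real) \<Rightarrow>
   real \<Rightarrow> (real^'d \<Rightarrow> real) set \<Rightarrow> (real^'d \<Rightarrow> real) set \<Rightarrow> (real^'d \<Rightarrow> real) set \<Rightarrow> bool" where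
  "variational \<Omega> \<gamma> f K C M \<phi> \<mu> \<theta> t \<Psi> \<Xi> W \<longleftrightarrow>
     (\<forall>\<psi>\<in>\<Psi>. V1 \<Omega> C M \<phi> \<mu> \<theta> t \<psi>) \<and>
     (\<forall>\<xi>\<in>\<Xi>. V2 \<Omega> \<gamma> f \<phi> \<mu> \<theta> t \<xi>) \<and>
     (\<forall>\<omega>\<in>W. V3 \<Omega> \<gamma> f K C M \<phi> \<mu> \<theta> t \<omega>)"

definition balance_laws ::
  "(real^'d) set \<Rightarrow> real \<Rightarrow> (real \<Rightarrow> real \<Rightarrow> real) \<Rightarrow> 'd coeff \<Rightarrow> 'd coeff \<Rightarrow> 'd coeff \<Rightarrow>
   (real \<Rightarrow> real^'d \<Rightarrow> real) \<Rightarrow> (real \<Rightarrow> real^'d \<Rightarrow> real) \<Rightarrow> (real \<Rightarrow> real^'d \<Rightarrow> real) \<Rightarrow>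
   real \<Rightarrow> bool" where
  "balance_laws \<Omega> \<gamma> f K C M \<phi> \<mu> \<theta> t \<longleftrightarrow>
     (let D = dissipation \<Omega>
            (\<lambda>x. onsager (at_state K \<phi> \<theta> t x) (at_state C \<phi> \<theta> t x) (at_state M \<phi> \<theta> t x))
            (\<lambda>x. \<mu> t x / \<theta> t x) (\<lambda>x. 1 / \<theta> t x)
      in ip \<Omega> (dt \<phi> t) (\<lambda>_. 1) = 0 \<and>
         ip \<Omega> (dt (energy f \<phi> \<theta>) t) (\<lambda>_. 1) = 0 \<and>
         ip \<Omega> (dt (entropy \<gamma> f \<phi> \<theta>) t) (\<lambda>_. 1) = D \<and> D \<ge> 0)"

end

theory Submission
  imports Defs
begin

text \<open>
  The test function \<open>1\<close> in (V1) gives mass conservation. In (V3) it gives entropy production, because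
  the two fluxes paired with \<open>\<nabla>\<theta>/\<theta>\<^sup>2\<close> and \<open>\<nabla>\<mu>/\<theta>\<close> recombine pointwise into the Onsager quadratic form in
  \<open>(\<nabla>(1/\<theta>), \<nabla>(\<mu>/\<theta>))\<close>. For the energy, the chain rule yields
  \<open>e\<^sub>t = f\<^sub>\<phi> \<phi>\<^sub>t + \<theta> s\<^sub>t + \<gamma> \<theta> \<nabla>\<phi> \<bullet> \<nabla>\<phi>\<^sub>t\<close>; this uses \<open>(\<nabla>\<phi>)\<^sub>t = \<nabla>\<phi>\<^sub>t\<close>, that is, symmetry of the
  second derivatives of \<open>\<phi>\<close>. Testing (V3) with \<open>\<theta>\<close> annihilates the heat flux, and the remaining
  terms cancel against (V1) tested with \<open>\<mu>\<close> and (V2) tested with \<open>\<phi>\<^sub>t\<close>.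
\<close>

section \<open>Functions of class C^k\<close>

lemma Ck_on_SucD:
  assumes "Ck_on (Suc k) S g"
  shows "x \<in> S \<Longrightarrow> (g has_derivative frechet_derivative g (at x)) (at x)"
    and "Ck_on k S (\<lambda>x. frechet_derivative g (at x) v)"
  using assms by (auto simp: frechet_derivative_works)

lemma Ck_on_Suc_continuous_on:
  assumes "Ck_on (Suc k) S g"
  shows "continuous_on S g"
  using Ck_on_SucD(1)[OF assms]
  by (meson continuous_at_imp_continuous_on has_derivative_continuous)

section \<open>Symmetry of second derivatives by second differences\<close>

lemma mean_value_direction:
  fixes g :: "'a::real_normed_vector \<Rightarrow> real"
  assumes "s > 0"
    and "\<And>r. 0 \<le> r \<Longrightarrow> r \<le> s \<Longrightarrow> (g has_derivative G (z + r *\<^sub>R u)) (at (z + r *\<^sub>R u))"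
  obtains r where "0 < r" "r < s" "g (z + s *\<^sub>R u) - g z = s * G (z + r *\<^sub>R u) u"
proof -
  \<comment> \<open>Restricting \<open>g\<close> to the line through \<open>z\<close> in direction
    \<open>u\<close> reduces the claim to one variable; linearity of the derivative turns the
    composite derivative into a real one.\<close>
  have "((\<lambda>r. g (z + r *\<^sub>R u)) has_real_derivative G (z + r *\<^sub>R u) u) (at r)"
    if "0 \<le> r" "r \<le> s" for r
  proof -
    have "((\<lambda>r. g (z + r *\<^sub>R u)) has_derivative (\<lambda>h. G (z + r *\<^sub>R u) (h *\<^sub>R u))) (at r)"
      by (rule has_derivative_compose[where g=g and g'="G (z + r *\<^sub>R u)"])
        (auto intro!: derivative_eq_intros assms(2)[OF that])
    moreover have "G (z + r *\<^sub>R u) (h *\<^sub>R u) = G (z + r *\<^sub>R u) u * h" for h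
      using linear_cmul[OF has_derivative_linear[OF assms(2)[OF that]]] by simp
    ultimately show ?thesis
      by (simp add: has_field_derivative_def)
  qed
  then obtain r where "0 < r" "r < s"
    "g (z + s *\<^sub>R u) - g (z + 0 *\<^sub>R u) = (s - 0) * G (z + r *\<^sub>R u) u"
    using MVT2[OF \<open>s > 0\<close>, of "\<lambda>r. g (z + r *\<^sub>R u)" "\<lambda>r. G (z + r *\<^sub>R u) u"] by blast
  then show thesis
    using that by simp
qed

text \<open>The mean value theorem is applied twice: to the increment of \<open>g\<close> by
  \<open>s *\<^sub>R v\<close> along direction \<open>u\<close>, and then to the directional
  derivative of \<open>g\<close> along \<open>u\<close>, moved in direction \<open>v\<close>. The
  parallelogram lies in \<open>S\<close>, hence so do both segments.\<close>

lemma second_difference: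
  fixes g :: "'a::euclidean_space \<Rightarrow> real"
  assumes g: "Ck_on 2 S g" and "s > 0"
    and sub: "\<And>r q. 0 \<le> r \<Longrightarrow> r \<le> s \<Longrightarrow> 0 \<le> q \<Longrightarrow> q \<le> s \<Longrightarrow> z + r *\<^sub>R u + q *\<^sub>R v \<in> S"
  obtains r q where "0 < r" "r < s" "0 < q" "q < s"
    "g (z + s *\<^sub>R u + s *\<^sub>R v) - g (z + s *\<^sub>R u) - g (z + s *\<^sub>R v) + g z =
      s\<^sup>2 * frechet_derivative (\<lambda>x. frechet_derivative g (at x) u) (at (z + r *\<^sub>R u + q *\<^sub>R v)) v"
proof -
  note g = g[unfolded numeral_2_eq_2]
  let ?D = "\<lambda>x. frechet_derivative g (at x)"
  have "((\<lambda>x. g (x + s *\<^sub>R v) - g x) has_derivative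
      (\<lambda>h. ?D (z + r *\<^sub>R u + s *\<^sub>R v) h - ?D (z + r *\<^sub>R u) h)) (at (z + r *\<^sub>R u))"
    if "0 \<le> r" "r \<le> s" for r
  proof (rule has_derivative_diff)
    show "(g has_derivative ?D (z + r *\<^sub>R u)) (at (z + r *\<^sub>R u))"
      using Ck_on_SucD(1)[OF g] sub[of r 0] that by simp
    have "(g has_derivative ?D (z + r *\<^sub>R u + s *\<^sub>R v)) (at (z + r *\<^sub>R u + s *\<^sub>R v))"
      using Ck_on_SucD(1)[OF g] sub[of r s] that \<open>s > 0\<close> by simp
    then show "((\<lambda>x. g (x + s *\<^sub>R v)) has_derivative ?D (z + r *\<^sub>R u + s *\<^sub>R v)) (at (z + r *\<^sub>R u))"
      by (rule has_derivative_compose[rotated]) (auto intro!: derivative_eq_intros)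
  qed
  from mean_value_direction[OF \<open>s > 0\<close>, of _
      "\<lambda>y h. ?D (y + s *\<^sub>R v) h - ?D y h" z u, OF this]
  obtain r where r: "0 < r" "r < s"
    and 1: "g (z + s *\<^sub>R u + s *\<^sub>R v) - g (z + s *\<^sub>R u) - (g (z + s *\<^sub>R v) - g z) =
      s * (?D (z + r *\<^sub>R u + s *\<^sub>R v) u - ?D (z + r *\<^sub>R u) u)"
    by blast
  have "((\<lambda>x. ?D x u) has_derivative frechet_derivative (\<lambda>x. ?D x u) (at (z + r *\<^sub>R u + q *\<^sub>R v)))
      (at (z + r *\<^sub>R u + q *\<^sub>R v))" if "0 \<le> q" "q \<le> s" for q
    using Ck_on_SucD(1)[OF Ck_on_SucD(2)[OF g]] sub r that by simp
  from mean_value_direction[OF \<open>s > 0\<close>, of _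
      "\<lambda>y. frechet_derivative (\<lambda>x. ?D x u) (at y)" "z + r *\<^sub>R u" v, OF this]
  obtain q where "0 < q" "q < s"
    and "?D (z + r *\<^sub>R u + s *\<^sub>R v) u - ?D (z + r *\<^sub>R u) u =
      s * frechet_derivative (\<lambda>x. ?D x u) (at (z + r *\<^sub>R u + q *\<^sub>R v)) v"
    by blast
  with r 1 that show thesis
    by (simp add: power2_eq_square)
qed

text \<open>The second difference does not change when \<open>u\<close> and \<open>v\<close> are
  exchanged. So the two mixed derivatives take a common value at points as near to \<open>z\<close>
  as desired, and their continuity forces equality at \<open>z\<close>.\<close>

lemma mixed_derivatives_commute:
  fixes g :: "'a::euclidean_space \<Rightarrow> real"
  assumes "open S" "z \<in> S" and g: "Ck_on 2 S g"
  shows "frechet_derivative (\<lambda>x. frechet_derivative g (at x) u) (at z) v =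
    frechet_derivative (\<lambda>x. frechet_derivative g (at x) v) (at z) u"
proof (rule ccontr)
  let ?A = "\<lambda>u v z. frechet_derivative (\<lambda>x. frechet_derivative g (at x) u) (at z) v"
  assume ne: "?A u v z \<noteq> ?A v u z"
  \<comment> \<open>Half of the supposed gap: if a common value is within \<open>e\<close> of both
    numbers, they differ by less than \<open>2 * e\<close>, a contradiction.\<close>
  define e where "e = \<bar>?A u v z - ?A v u z\<bar> / 2"
  have "e > 0"
    using ne by (simp add: e_def)
  have "continuous (at z) (?A u v)" for u v
    using Ck_on_SucD(2)[OF Ck_on_SucD(2)[OF g[unfolded numeral_2_eq_2]]] \<open>open S\<close> \<open>z \<in> S\<close>
    by (simp add: continuous_on_eq_continuous_at)
  then have near_A: "\<exists>d>0. \<forall>y. dist y z < d \<longrightarrow> dist (?A u v y) (?A u v z) < e" for u v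
    using \<open>e > 0\<close> unfolding continuous_at_eps_delta by blast
  obtain d1 where d1: "d1 > 0" "\<And>y. dist y z < d1 \<Longrightarrow> dist (?A u v y) (?A u v z) < e"
    using near_A[of u v] by blast
  obtain d2 where d2: "d2 > 0" "\<And>y. dist y z < d2 \<Longrightarrow> dist (?A v u y) (?A v u z) < e"
    using near_A[of v u] by blast
  obtain d3 where d3: "d3 > 0" "\<And>y. dist y z < d3 \<Longrightarrow> y \<in> S"
    using \<open>open S\<close> \<open>z \<in> S\<close> unfolding open_dist by blast
  define d where "d = min d1 (min d2 d3)"
  \<comment> \<open>This gives \<open>s * (norm u + norm v) < d\<close>, so the parallelogram stays
    within distance \<open>d\<close> of \<open>z\<close>; the summand \<open>1\<close> keeps the
    denominator positive even for \<open>u = v = 0\<close>.\<close>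
  define s where "s = d / (norm u + norm v + 1)"
  have N: "norm u + norm v + 1 > 0"
    by (smt (verit) norm_ge_zero)
  have "d > 0" "s > 0"
    using d1(1) d2(1) d3(1) N by (auto simp: d_def s_def)
  have near: "dist (z + r *\<^sub>R u + q *\<^sub>R v) z < d"
    if "0 \<le> r" "r \<le> s" "0 \<le> q" "q \<le> s" for r q
  proof -
    have "dist (z + r *\<^sub>R u + q *\<^sub>R v) z \<le> r * norm u + q * norm v"
      using norm_triangle_ineq[of "r *\<^sub>R u" "q *\<^sub>R v"] that by (simp add: dist_norm)
    also have "\<dots> \<le> s * norm u + s * norm v"
      using that by (intro add_mono mult_right_mono) auto
    also have "\<dots> < s * (norm u + norm v + 1)"
      using \<open>s > 0\<close> by (simp add: algebra_simps)
    also have "\<dots> = d"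
      using N by (simp add: s_def)
    finally show ?thesis .
  qed
  have in_S: "z + r *\<^sub>R u + q *\<^sub>R v \<in> S"
    if "0 \<le> r" "r \<le> s" "0 \<le> q" "q \<le> s" for r q
    using d3(2) near[OF that] by (simp add: d_def)
  have in_S': "z + r *\<^sub>R v + q *\<^sub>R u \<in> S"
    if "0 \<le> r" "r \<le> s" "0 \<le> q" "q \<le> s" for r q
    using in_S[of q r] that by (simp add: add_ac)
  obtain r q where rq: "0 < r" "r < s" "0 < q" "q < s"
    "g (z + s *\<^sub>R u + s *\<^sub>R v) - g (z + s *\<^sub>R u) - g (z + s *\<^sub>R v) + g z =
      s\<^sup>2 * ?A u v (z + r *\<^sub>R u + q *\<^sub>R v)"
    using second_difference[OF g \<open>s > 0\<close> in_S] by blast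
  obtain r' q' where rq': "0 < r'" "r' < s" "0 < q'" "q' < s"
    "g (z + s *\<^sub>R v + s *\<^sub>R u) - g (z + s *\<^sub>R v) - g (z + s *\<^sub>R u) + g z =
      s\<^sup>2 * ?A v u (z + r' *\<^sub>R v + q' *\<^sub>R u)"
    using second_difference[OF g \<open>s > 0\<close> in_S'] by blast
  have "s\<^sup>2 * ?A u v (z + r *\<^sub>R u + q *\<^sub>R v) = s\<^sup>2 * ?A v u (z + q' *\<^sub>R u + r' *\<^sub>R v)"
  proof -
    have swap: "z + \<alpha> *\<^sub>R v + \<beta> *\<^sub>R u = z + \<beta> *\<^sub>R u + \<alpha> *\<^sub>R v" for \<alpha> \<beta>
      by (simp add: add_ac)
    show ?thesis
      using rq(5) rq'(5) unfolding swap[of s s] swap[of r' q'] by linarith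
  qed
  then have "?A u v (z + r *\<^sub>R u + q *\<^sub>R v) = ?A v u (z + q' *\<^sub>R u + r' *\<^sub>R v)"
    using \<open>s > 0\<close> by simp
  moreover have "\<bar>?A u v (z + r *\<^sub>R u + q *\<^sub>R v) - ?A u v z\<bar> < e"
    "\<bar>?A v u (z + q' *\<^sub>R u + r' *\<^sub>R v) - ?A v u z\<bar> < e"
    using d1(2)[of "z + r *\<^sub>R u + q *\<^sub>R v"] d2(2)[of "z + q' *\<^sub>R u + r' *\<^sub>R v"]
      near[of r q] near[of q' r'] rq(1-4) rq'(1-4)
    by (simp_all add: d_def dist_real_def)
  ultimately have "\<bar>?A u v z - ?A v u z\<bar> < 2 * e"
    by linarith
  then show False
    by (simp add: e_def)
qed

section \<open>Gradients and time derivatives\<close>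

lemma has_derivative_slices:
  assumes "(F has_derivative F') (at (s, y))"
  shows "((\<lambda>x. F (s, x)) has_derivative (\<lambda>v. F' (0, v))) (at y)"
    and "((\<lambda>\<tau>. F (\<tau>, y)) has_derivative (\<lambda>h. F' (h, 0))) (at s)"
proof -
  show "((\<lambda>x. F (s, x)) has_derivative (\<lambda>v. F' (0, v))) (at y)"
    by (rule has_derivative_compose[where g=F and g'=F']) (auto intro!: derivative_eq_intros assms)
  show "((\<lambda>\<tau>. F (\<tau>, y)) has_derivative (\<lambda>h. F' (h, 0))) (at s)"
    by (rule has_derivative_compose[where g=F and g'=F']) (auto intro!: derivative_eq_intros assms)
qed

lemma has_derivative_fst_real:
  fixes F :: "real \<times> 'a::real_normed_vector \<Rightarrow> real"
  assumes "(F has_derivative F') (at (s, y))"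
  shows "((\<lambda>\<tau>. F (\<tau>, y)) has_real_derivative F' (1, 0)) (at s)"
proof -
  have "(\<lambda>h. F' (h, 0)) = (*) (F' (1, 0))"
  proof
    show "F' (h, 0) = F' (1, 0) * h" for h
      using linear_cmul[OF has_derivative_linear[OF assms], of h "(1, 0)"] by simp
  qed
  then show ?thesis
    using has_derivative_slices(2)[OF assms] by (simp add: has_field_derivative_def)
qed

lemma has_derivative_snd_real:
  fixes F :: "'a::real_normed_vector \<times> real \<Rightarrow> real"
  assumes "(F has_derivative F') (at (s, y))"
  shows "((\<lambda>\<tau>. F (s, \<tau>)) has_real_derivative F' (0, 1)) (at y)"
proof -
  have "(\<lambda>h. F' (0, h)) = (*) (F' (0, 1))"
  proof
    show "F' (0, h) = F' (0, 1) * h" for h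
      using linear_cmul[OF has_derivative_linear[OF assms], of h "(0, 1)"] by simp
  qed
  then show ?thesis
    using has_derivative_slices(1)[OF assms] by (simp add: has_field_derivative_def)
qed

lemma has_real_derivative_Pair:
  fixes F :: "real \<times> real \<Rightarrow> real"
  assumes "(F has_derivative F') (at (u t, v t))"
    and "(u has_real_derivative u') (at t)" "(v has_real_derivative v') (at t)"
  shows "((\<lambda>\<tau>. F (u \<tau>, v \<tau>)) has_real_derivative u' * F' (1, 0) + v' * F' (0, 1)) (at t)"
proof -
  have "((\<lambda>\<tau>. F (u \<tau>, v \<tau>)) has_derivative (\<lambda>h. F' (u' * h, v' * h))) (at t)"
    using assms(2,3) unfolding has_field_derivative_def
    by (intro has_derivative_compose[where g=F and g'=F' and f="\<lambda>\<tau>. (u \<tau>, v \<tau>)", OF _ assms(1)]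
        has_derivative_Pair)
  moreover have "F' (u' * h, v' * h) = (u' * F' (1, 0) + v' * F' (0, 1)) * h" for h
  proof -
    note lin = has_derivative_linear[OF assms(1)]
    have "(u' * h, v' * h) = (u' * h) *\<^sub>R (1, 0) + (v' * h) *\<^sub>R (0::real, 1::real)"
      by simp
    then have "F' (u' * h, v' * h) = (u' * h) * F' (1, 0) + (v' * h) * F' (0, 1)"
      by (simp only: linear_add[OF lin] linear_cmul[OF lin] real_scaleR_def)
    then show ?thesis
      by (simp add: algebra_simps)
  qed
  ultimately show ?thesis
    by (simp add: has_field_derivative_def)
qed

section \<open>Rules for \<open>grad\<close>, obtained from those for \<open>GDERIV\<close>\<close>

lemma grad_eqI:
  assumes "GDERIV u x :> D"
  shows "grad u x = D"
proof -
  have "frechet_derivative u (at x) = (\<lambda>h. h \<bullet> D)"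
    using frechet_derivative_at[OF assms[unfolded gderiv_def]] by simp
  then show ?thesis
    by (simp add: grad_def vec_eq_iff inner_axis')
qed

text \<open>\<open>grad\<close> records the derivative only on the axis vectors; linearity and
  expansion in that basis recover the whole derivative.\<close>

lemma GDERIV_grad:
  fixes u :: "real^'d \<Rightarrow> real"
  assumes "u differentiable (at x)"
  shows "GDERIV u x :> grad u x"
proof -
  have D: "(u has_derivative frechet_derivative u (at x)) (at x)"
    using assms frechet_derivative_works by blast
  have "frechet_derivative u (at x) = (\<lambda>h. h \<bullet> grad u x)"
  proof
    fix h
    have "frechet_derivative u (at x) h = frechet_derivative u (at x) (\<Sum>i\<in>UNIV. h $ i *\<^sub>R axis i 1)"
      by (simp only: scalar_mult_eq_scaleR[symmetric] basis_expansion)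
    also have "\<dots> = (\<Sum>i\<in>UNIV. h $ i *\<^sub>R frechet_derivative u (at x) (axis i 1))"
      using has_derivative_linear[OF D] by (simp add: linear_sum linear_cmul)
    finally show "frechet_derivative u (at x) h = h \<bullet> grad u x"
      by (simp add: grad_def inner_vec_def)
  qed
  then show ?thesis
    using D unfolding gderiv_def by simp
qed

lemma grad_const: "grad (\<lambda>_. c) x = 0"
  by (intro grad_eqI GDERIV_const)

lemma grad_reciprocal:
  assumes "v differentiable (at x)" "v x \<noteq> 0"
  shows "grad (\<lambda>x. 1 / v x) x = - (1 / (v x)\<^sup>2) *\<^sub>R grad v x"
proof (rule grad_eqI)
  show "GDERIV (\<lambda>x. 1 / v x) x :> - (1 / (v x)\<^sup>2) *\<^sub>R grad v x"
    using GDERIV_inverse[OF GDERIV_grad[OF assms(1)] assms(2)]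
    by (simp add: inverse_eq_divide power_divide)
qed

lemma grad_divide:
  assumes "u differentiable (at x)" "v differentiable (at x)" "v x \<noteq> 0"
  shows "grad (\<lambda>x. u x / v x) x = (1 / v x) *\<^sub>R grad u x - (u x / (v x)\<^sup>2) *\<^sub>R grad v x"
proof (rule grad_eqI)
  show "GDERIV (\<lambda>x. u x / v x) x :> (1 / v x) *\<^sub>R grad u x - (u x / (v x)\<^sup>2) *\<^sub>R grad v x"
    using GDERIV_mult[OF GDERIV_grad[OF assms(1)]
        GDERIV_inverse[OF GDERIV_grad[OF assms(2)] assms(3)]]
    by (simp add: divide_inverse power_inverse)
qed

section \<open>Regularity of test functions\<close>

lemma smooth_onD: "smooth_on S g \<Longrightarrow> Ck_on k S g"
  by (simp add: smooth_on_def)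

lemma test_function_regularity:
  assumes "u \<in> test_functions l"
  shows "u differentiable (at x)" "continuous_on UNIV u" "continuous_on UNIV (grad u)"
proof -
  have "Ck_on (Suc 0) UNIV u"
    using assms by (auto simp: test_functions_def smooth_on_def)
  then show "u differentiable (at x)" "continuous_on UNIV u" "continuous_on UNIV (grad u)"
    using Ck_on_Suc_continuous_on[of 0 UNIV u]
    by (auto simp: grad_def[abs_def] intro!: continuous_on_vec_lambda)
qed

lemma const_test_function: "(\<lambda>_ :: real^'d. c) \<in> test_functions l"
proof -
  \<comment> \<open>The constant stays arbitrary in the induction, because differentiation replaces
    it by \<open>0\<close>.\<close>
  have "Ck_on k UNIV (\<lambda>_ :: real^'d. c)" for k and c :: real
    by (induction k arbitrary: c) simp_all
  then show ?thesis
    by (simp add: test_functions_def smooth_on_def periodic_def)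
qed

section \<open>Gradient and time derivative read off the joint space-time derivative\<close>

lemma grad_slice:
  assumes "(\<lambda>(t, x). \<phi> t x) differentiable (at (t, x))"
  shows "grad (\<phi> t) x $ i = frechet_derivative (\<lambda>(t, x). \<phi> t x) (at (t, x)) (0, axis i 1)"
proof -
  have "frechet_derivative (\<phi> t) (at x) = (\<lambda>v. frechet_derivative (\<lambda>(t, x). \<phi> t x) (at (t, x)) (0, v))"
    using frechet_derivative_at[OF has_derivative_slices(1)[OF assms[unfolded frechet_derivative_works]]]
    by simp
  then show ?thesis
    unfolding grad_def by (simp only: vec_lambda_beta)
qed

lemma
  assumes "(\<lambda>(t, x). \<phi> t x) differentiable (at (t, x))"
  shows has_real_derivative_dt: "((\<lambda>\<tau>. \<phi> \<tau> x) has_real_derivative dt \<phi> t x) (at t)"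
    and dt_slice: "dt \<phi> t x = frechet_derivative (\<lambda>(t, x). \<phi> t x) (at (t, x)) (1, 0)"
proof -
  have "((\<lambda>\<tau>. \<phi> \<tau> x) has_real_derivative
      frechet_derivative (\<lambda>(t, x). \<phi> t x) (at (t, x)) (1, 0)) (at t)"
    using has_derivative_fst_real[OF assms[unfolded frechet_derivative_works]] by simp
  then show "((\<lambda>\<tau>. \<phi> \<tau> x) has_real_derivative dt \<phi> t x) (at t)"
    "dt \<phi> t x = frechet_derivative (\<lambda>(t, x). \<phi> t x) (at (t, x)) (1, 0)"
    by (simp_all add: dt_def DERIV_imp_deriv)
qed

text \<open>Both expressions are mixed second derivatives of the space-time function in the
  directions \<open>(1, 0)\<close> and \<open>(0, axis i 1)\<close>, taken in opposite
  orders.\<close>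

lemma has_real_derivative_grad:
  fixes \<phi> :: "real \<Rightarrow> real^'d \<Rightarrow> real"
  assumes C2: "Ck_on 2 ({0<..<T} \<times> UNIV) (\<lambda>(t, x). \<phi> t x)" and t: "t \<in> {0<..<T}"
  shows "((\<lambda>\<tau>. grad (\<phi> \<tau>) x $ i) has_real_derivative grad (dt \<phi> t) x $ i) (at t)"
proof -
  let ?\<Phi> = "\<lambda>(t, x). \<phi> t x" and ?S = "{0<..<T} \<times> (UNIV :: (real^'d) set)"
  note C2' = C2[unfolded numeral_2_eq_2]
  have diff: "?\<Phi> differentiable (at (\<tau>, y))" if "\<tau> \<in> {0<..<T}" for \<tau> y
    using C2' that by auto
  have D2: "((\<lambda>z. frechet_derivative ?\<Phi> (at z) v) has_derivative
      frechet_derivative (\<lambda>z. frechet_derivative ?\<Phi> (at z) v) (at (t, x))) (at (t, x))" for v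
    using Ck_on_SucD(1)[OF Ck_on_SucD(2)[OF C2']] t by simp
  have dt: "dt \<phi> t = (\<lambda>y. frechet_derivative ?\<Phi> (at (t, y)) (1, 0))"
    using dt_slice[OF diff[OF t]] by blast
  have "((\<lambda>\<tau>. frechet_derivative ?\<Phi> (at (\<tau>, x)) (0, axis i 1)) has_real_derivative
      frechet_derivative (\<lambda>z. frechet_derivative ?\<Phi> (at z) (0, axis i 1)) (at (t, x)) (1, 0)) (at t)"
    by (rule has_derivative_fst_real[OF D2])
  moreover have "frechet_derivative (\<lambda>z. frechet_derivative ?\<Phi> (at z) (0, axis i 1)) (at (t, x)) (1, 0) =
      frechet_derivative (\<lambda>z. frechet_derivative ?\<Phi> (at z) (1, 0)) (at (t, x)) (0, axis i 1)"
    using t by (intro mixed_derivatives_commute[OF _ _ C2]) (auto intro: open_Times)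
  moreover have "grad (dt \<phi> t) x $ i =
      frechet_derivative (\<lambda>z. frechet_derivative ?\<Phi> (at z) (1, 0)) (at (t, x)) (0, axis i 1)"
    unfolding grad_def dt vec_lambda_beta
    using frechet_derivative_at[OF has_derivative_slices(1)[OF D2, of "(1, 0)"]] by metis
  ultimately have "((\<lambda>\<tau>. frechet_derivative ?\<Phi> (at (\<tau>, x)) (0, axis i 1)) has_real_derivative
      grad (dt \<phi> t) x $ i) (at t)"
    by simp
  \<comment> \<open>The gradient is identified with the joint derivative for times in
    \<open>{0<..<T}\<close>; this set is open and contains \<open>t\<close>, so the two have the
    same time derivative at \<open>t\<close>.\<close>
  then show ?thesis
    by (rule has_field_derivative_transform_within_open[OF _ _ t])
      (use grad_slice[OF diff] in auto)
qed

text \<open>Links the partial derivative to the Frechet derivative, for which the chain rule and the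
  continuity from class C^1 are available.\<close>

lemma d\<phi>_eq:
  assumes "(\<lambda>(p, r). f p r) differentiable (at (p, r))"
  shows "d\<phi> f p r = frechet_derivative (\<lambda>(p, r). f p r) (at (p, r)) (1, 0)"
  using has_derivative_fst_real[OF assms[unfolded frechet_derivative_works]]
  by (simp add: d\<phi>_def DERIV_imp_deriv)

lemma d\<theta>_eq:
  assumes "(\<lambda>(p, r). f p r) differentiable (at (p, r))"
  shows "d\<theta> f p r = frechet_derivative (\<lambda>(p, r). f p r) (at (p, r)) (0, 1)"
  using has_derivative_snd_real[OF assms[unfolded frechet_derivative_works]]
  by (simp add: d\<theta>_def DERIV_imp_deriv)

section \<open>Time derivatives of the entropy and energy densities\<close>

context
  fixes \<gamma> l T t :: real and f :: "real \<Rightarrow> real \<Rightarrow> real"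
    and \<phi> \<mu> \<theta> :: "real \<Rightarrow> real^'d \<Rightarrow> real"
  assumes f: "smooth_on (UNIV \<times> {0<..}) (\<lambda>(p, r). f p r)"
    and reg: "regular l T \<phi> \<mu> \<theta>"
    and positive: "\<forall>t\<in>{0<..<T}. \<forall>x. \<theta> t x > 0"
    and t: "t \<in> {0<..<T}"
begin

section \<open>Regularity of the state at the fixed time \<open>t\<close>\<close>

lemma \<theta>_pos: "\<tau> \<in> {0<..<T} \<Longrightarrow> \<theta> \<tau> x > 0"
  using positive by blast

lemma \<phi>_C2: "Ck_on (Suc (Suc 0)) ({0<..<T} \<times> UNIV) (\<lambda>(t, x). \<phi> t x)"
  and \<theta>_C1: "Ck_on (Suc 0) ({0<..<T} \<times> UNIV) (\<lambda>(t, x). \<theta> t x)"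
  using reg by (simp_all add: regular_def numeral_2_eq_2)

lemma f_differentiable: "r > 0 \<Longrightarrow> (\<lambda>(p, r). f p r) differentiable (at (p, r))"
  using smooth_onD[OF f, of "Suc 0"] by auto

lemma \<phi>_differentiable: "\<tau> \<in> {0<..<T} \<Longrightarrow> (\<lambda>(t, x). \<phi> t x) differentiable (at (\<tau>, x))"
  using \<phi>_C2 by auto

lemma \<theta>_differentiable: "\<tau> \<in> {0<..<T} \<Longrightarrow> (\<lambda>(t, x). \<theta> t x) differentiable (at (\<tau>, x))"
  using \<theta>_C1 by auto

lemma continuous_on_slice:
  assumes "continuous_on ({0<..<T} \<times> UNIV) F"
  shows "continuous_on UNIV (\<lambda>x. F (t, x))"
  using t by (intro continuous_on_compose2[OF assms] continuous_intros) auto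

lemma continuous_\<phi>: "continuous_on UNIV (\<phi> t)"
  using continuous_on_slice[OF Ck_on_Suc_continuous_on[OF \<phi>_C2]] by simp

text \<open>\<open>regular\<close> does not list \<open>\<phi> t\<close> among the test functions,
  so the continuity is drawn from the joint class C^2 of \<open>\<phi>\<close>.\<close>

lemma continuous_grad_\<phi>: "continuous_on UNIV (grad (\<phi> t))"
proof -
  have "continuous_on UNIV (\<lambda>x. frechet_derivative (\<lambda>(t, x). \<phi> t x) (at (t, x)) v)" for v
    by (rule continuous_on_slice[OF Ck_on_Suc_continuous_on[OF Ck_on_SucD(2)[OF \<phi>_C2]]])
  then have "continuous_on UNIV (\<lambda>x. \<chi> i. frechet_derivative (\<lambda>(t, x). \<phi> t x) (at (t, x)) (0, axis i 1))"
    by (intro continuous_on_vec_lambda)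
  moreover have "grad (\<phi> t) = (\<lambda>x. \<chi> i. frechet_derivative (\<lambda>(t, x). \<phi> t x) (at (t, x)) (0, axis i 1))"
    by (simp add: fun_eq_iff vec_eq_iff grad_slice[OF \<phi>_differentiable[OF t]])
  ultimately show ?thesis
    by simp
qed

lemma continuous_dt_\<theta>: "continuous_on UNIV (dt \<theta> t)"
proof -
  have "continuous_on UNIV (\<lambda>x. frechet_derivative (\<lambda>(t, x). \<theta> t x) (at (t, x)) (1, 0))"
    using Ck_on_SucD(2)[OF \<theta>_C1] by (intro continuous_on_slice) simp
  moreover have "dt \<theta> t = (\<lambda>x. frechet_derivative (\<lambda>(t, x). \<theta> t x) (at (t, x)) (1, 0))"
    using dt_slice[OF \<theta>_differentiable[OF t]] by blast
  ultimately show ?thesis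
    by simp
qed

lemma test_fns: "\<mu> t \<in> test_functions l" "dt \<phi> t \<in> test_functions l" "\<theta> t \<in> test_functions l"
  using reg t by (auto simp: regular_def)

text \<open>Positivity of \<open>\<theta>\<close> keeps the state inside the open set on which
  \<open>f\<close> is smooth.\<close>

lemma continuous_of_state:
  assumes "continuous_on (UNIV \<times> {0<..}) G"
  shows "continuous_on UNIV (\<lambda>x. G (\<phi> t x, \<theta> t x))"
  using \<theta>_pos[OF t] continuous_\<phi> test_function_regularity(2)[OF test_fns(3)]
  by (intro continuous_on_compose2[OF assms] continuous_intros) auto

lemma continuous_at_state:
  assumes "Ck_on 1 (UNIV \<times> UNIV \<times> {0<..}) (\<lambda>(p, q, r). A p q r)"
  shows "continuous_on UNIV (at_state A \<phi> \<theta> t)"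
proof -
  have A: "continuous_on (UNIV \<times> UNIV \<times> {0<..}) (\<lambda>(p, q, r). A p q r)"
    using assms Ck_on_Suc_continuous_on[of 0] unfolding One_nat_def by blast
  have "continuous_on UNIV (\<lambda>x. (\<phi> t x, grad (\<phi> t) x, \<theta> t x))"
    by (intro continuous_on_Pair continuous_\<phi> continuous_grad_\<phi>
        test_function_regularity(2)[OF test_fns(3)])
  then have "continuous_on UNIV (\<lambda>x. (\<lambda>(p, q, r). A p q r) (\<phi> t x, grad (\<phi> t) x, \<theta> t x))"
    by (rule continuous_on_compose2[OF A]) (use \<theta>_pos[OF t] in auto)
  then show ?thesis
    by (simp add: at_state_def[abs_def])
qed

lemma continuous_d\<phi>: "continuous_on UNIV (\<lambda>x. d\<phi> f (\<phi> t x) (\<theta> t x))"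
proof -
  have "continuous_on UNIV (\<lambda>x. frechet_derivative (\<lambda>(p, r). f p r) (at (\<phi> t x, \<theta> t x)) (1, 0))"
    using Ck_on_SucD(2)[OF smooth_onD[OF f], of 0] by (intro continuous_of_state) simp
  then show ?thesis
    by (simp add: d\<phi>_eq[OF f_differentiable[OF \<theta>_pos[OF t]]])
qed

text \<open>Both claims come from one chain rule formula, \<open>?G'\<close>: it computes the
  derivative, and it is visibly continuous in \<open>x\<close>.\<close>

lemma
  shows has_derivative_d\<theta>: "((\<lambda>\<tau>. d\<theta> f (\<phi> \<tau> x) (\<theta> \<tau> x)) has_real_derivative
      dt (\<lambda>\<tau> x. d\<theta> f (\<phi> \<tau> x) (\<theta> \<tau> x)) t x) (at t)"
    and continuous_dt_d\<theta>: "continuous_on UNIV (dt (\<lambda>\<tau> x. d\<theta> f (\<phi> \<tau> x) (\<theta> \<tau> x)) t)"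
proof -
  define G where "G z = frechet_derivative (\<lambda>(p, r). f p r) (at z) (0, 1)" for z
  have G: "Ck_on (Suc 0) (UNIV \<times> {0<..}) G"
    using Ck_on_SucD(2)[OF smooth_onD[OF f], of "Suc 0"] by (simp add: G_def[abs_def])
  let ?G' = "\<lambda>x. dt \<phi> t x * frechet_derivative G (at (\<phi> t x, \<theta> t x)) (1, 0) +
    dt \<theta> t x * frechet_derivative G (at (\<phi> t x, \<theta> t x)) (0, 1)"
  have D: "((\<lambda>\<tau>. d\<theta> f (\<phi> \<tau> x) (\<theta> \<tau> x)) has_real_derivative ?G' x) (at t)" for x
  \<comment> \<open>\<open>G\<close> agrees with \<open>d\<theta> f\<close> where the second
    argument is positive, hence along the state throughout the open time interval.\<close>
  proof (rule has_field_derivative_transform_within_open[OF _ _ t])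
    show "((\<lambda>\<tau>. G (\<phi> \<tau> x, \<theta> \<tau> x)) has_real_derivative ?G' x) (at t)"
      by (intro has_real_derivative_Pair Ck_on_SucD(1)[OF G]
          has_real_derivative_dt[OF \<phi>_differentiable[OF t]]
          has_real_derivative_dt[OF \<theta>_differentiable[OF t]])
        (use \<theta>_pos[OF t] in auto)
    show "G (\<phi> \<tau> x, \<theta> \<tau> x) = d\<theta> f (\<phi> \<tau> x) (\<theta> \<tau> x)" if "\<tau> \<in> {0<..<T}" for \<tau>
      using d\<theta>_eq[OF f_differentiable[OF \<theta>_pos[OF that]]] by (simp add: G_def)
  qed simp
  then have eq: "dt (\<lambda>\<tau> x. d\<theta> f (\<phi> \<tau> x) (\<theta> \<tau> x)) t x = ?G' x" for x
    by (simp add: dt_def DERIV_imp_deriv)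
  then show "((\<lambda>\<tau>. d\<theta> f (\<phi> \<tau> x) (\<theta> \<tau> x)) has_real_derivative
      dt (\<lambda>\<tau> x. d\<theta> f (\<phi> \<tau> x) (\<theta> \<tau> x)) t x) (at t)"
    using D[of x] by (simp only: eq)
  have "continuous_on UNIV (\<lambda>x. frechet_derivative G (at (\<phi> t x, \<theta> t x)) v)" for v
    using Ck_on_SucD(2)[OF G] by (intro continuous_of_state) simp
  then have "continuous_on UNIV ?G'"
    using continuous_dt_\<theta> test_function_regularity(2)[OF test_fns(2)] by (intro continuous_intros)
  moreover have "dt (\<lambda>\<tau> x. d\<theta> f (\<phi> \<tau> x) (\<theta> \<tau> x)) t = ?G'"
    using eq by blast
  ultimately show "continuous_on UNIV (dt (\<lambda>\<tau> x. d\<theta> f (\<phi> \<tau> x) (\<theta> \<tau> x)) t)"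
    by simp
qed

lemma dt_entropy:
  "dt (entropy \<gamma> f \<phi> \<theta>) t x = - \<gamma> * (grad (\<phi> t) x \<bullet> grad (dt \<phi> t) x)
    - dt (\<lambda>\<tau> x. d\<theta> f (\<phi> \<tau> x) (\<theta> \<tau> x)) t x"
proof -
  have C2: "Ck_on 2 ({0<..<T} \<times> UNIV) (\<lambda>(t, x). \<phi> t x)"
    using \<phi>_C2 by (simp only: numeral_2_eq_2)
  \<comment> \<open>The time derivative of the gradient is known by components, so the squared norm
    is differentiated as a sum of squares.\<close>
  have "((\<lambda>\<tau>. \<Sum>i\<in>UNIV. (grad (\<phi> \<tau>) x $ i)\<^sup>2) has_real_derivative
      (\<Sum>i\<in>UNIV. 2 * (grad (\<phi> t) x $ i * grad (dt \<phi> t) x $ i))) (at t)"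
    by (rule DERIV_sum) (auto intro!: derivative_eq_intros has_real_derivative_grad[OF C2 t])
  moreover have "(\<Sum>i\<in>UNIV. (grad (\<phi> \<tau>) x $ i)\<^sup>2) = (norm (grad (\<phi> \<tau>) x))\<^sup>2" for \<tau>
    unfolding power2_norm_eq_inner inner_vec_def by (simp add: power2_eq_square)
  ultimately have "((\<lambda>\<tau>. (norm (grad (\<phi> \<tau>) x))\<^sup>2) has_real_derivative
      2 * (grad (\<phi> t) x \<bullet> grad (dt \<phi> t) x)) (at t)"
    by (simp add: inner_vec_def sum_distrib_left)
  then have "((\<lambda>\<tau>. - (\<gamma> / 2) * (norm (grad (\<phi> \<tau>) x))\<^sup>2 - d\<theta> f (\<phi> \<tau> x) (\<theta> \<tau> x)) has_real_derivative
      - (\<gamma> / 2) * (2 * (grad (\<phi> t) x \<bullet> grad (dt \<phi> t) x)) -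
      dt (\<lambda>\<tau> x. d\<theta> f (\<phi> \<tau> x) (\<theta> \<tau> x)) t x) (at t)"
    by (intro DERIV_diff DERIV_cmult has_derivative_d\<theta>)
  from DERIV_imp_deriv[OF this] show ?thesis
    by (simp add: dt_def[of "entropy \<gamma> f \<phi> \<theta>"] entropy_def)
qed

text \<open>The contributions of \<open>dt \<theta>\<close> cancel because \<open>\<theta>\<close> and \<open>- d\<theta> f\<close> are conjugate in the energy.\<close>

lemma dt_energy:
  "dt (energy f \<phi> \<theta>) t x = d\<phi> f (\<phi> t x) (\<theta> t x) * dt \<phi> t x
    - \<theta> t x * dt (\<lambda>\<tau> x. d\<theta> f (\<phi> \<tau> x) (\<theta> \<tau> x)) t x"
proof -
  note diff = f_differentiable[OF \<theta>_pos[OF t, of x], of "\<phi> t x"]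
  have d\<theta>: "((\<lambda>\<tau>. \<theta> \<tau> x) has_real_derivative dt \<theta> t x) (at t)"
    by (rule has_real_derivative_dt[OF \<theta>_differentiable[OF t]])
  have "((\<lambda>\<tau>. (\<lambda>(p, r). f p r) (\<phi> \<tau> x, \<theta> \<tau> x)) has_real_derivative
      dt \<phi> t x * d\<phi> f (\<phi> t x) (\<theta> t x) + dt \<theta> t x * d\<theta> f (\<phi> t x) (\<theta> t x)) (at t)"
    unfolding d\<phi>_eq[OF diff] d\<theta>_eq[OF diff]
    by (intro has_real_derivative_Pair diff[unfolded frechet_derivative_works] d\<theta>
        has_real_derivative_dt[OF \<phi>_differentiable[OF t]])
  then have "((\<lambda>\<tau>. f (\<phi> \<tau> x) (\<theta> \<tau> x)) has_real_derivative
      dt \<phi> t x * d\<phi> f (\<phi> t x) (\<theta> t x) + dt \<theta> t x * d\<theta> f (\<phi> t x) (\<theta> t x)) (at t)"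
    by simp
  from DERIV_imp_deriv[OF DERIV_diff[OF this DERIV_mult[OF d\<theta> has_derivative_d\<theta>]]] show ?thesis
    by (simp add: dt_def[of "energy f \<phi> \<theta>"] energy_def mult.commute)
qed

end

section \<open>The balance laws\<close>

lemma sum_UNIV_Plus:
  fixes g :: "'a::finite + 'b::finite \<Rightarrow> 'c::comm_monoid_add"
  shows "(\<Sum>i\<in>UNIV. g i) = (\<Sum>i\<in>UNIV. g (Inl i)) + (\<Sum>i\<in>UNIV. g (Inr i))"
  by (simp add: UNIV_Plus_UNIV[symmetric] sum.Plus del: UNIV_Plus_UNIV)

text \<open>Sums over \<open>'d + 'd\<close> split into blocks. The two cross terms stay apart,
  since they need not agree unless \<open>C\<close> is symmetric.\<close>

lemma onsager_quadratic_form: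
  "stack u v \<bullet> (onsager K C M *v stack u v) =
    u \<bullet> (K *v u) - u \<bullet> (C *v v) - v \<bullet> (C *v u) + v \<bullet> (M *v v)"
  by (simp add: onsager_def stack_def inner_vec_def matrix_vector_mult_def sum_UNIV_Plus
      sum_negf distrib_left right_diff_distrib sum.distrib sum_subtractf)

text \<open>Here \<open>u = \<nabla>\<theta>\<close>, \<open>v = \<nabla>\<mu>\<close>, \<open>m = \<mu>\<close> and \<open>r = \<theta>\<close>, so that \<open>q = \<nabla>(1/\<theta>)\<close> and \<open>p = \<nabla>(\<mu>/\<theta>)\<close>.\<close>

lemma entropy_production:
  fixes u v :: "real^'d" and K C M :: "real^'d^'d" and m r :: real
  defines "q \<equiv> - (1 / r\<^sup>2) *\<^sub>R u" and "p \<equiv> (1 / r) *\<^sub>R v - (m / r\<^sup>2) *\<^sub>R u"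
  shows "((1 / r\<^sup>2) *\<^sub>R (K *v u) + (1 / r) *\<^sub>R (C *v v) - (2 * (m / r\<^sup>2)) *\<^sub>R (C *v u)
        - (m / r) *\<^sub>R (M *v v) + (m / r)\<^sup>2 *\<^sub>R (M *v u)) \<bullet> ((1 / r\<^sup>2) *\<^sub>R u)
      + ((1 / r\<^sup>2) *\<^sub>R (C *v u) + (1 / r) *\<^sub>R (M *v v) - (m / r\<^sup>2) *\<^sub>R (M *v u)) \<bullet> ((1 / r) *\<^sub>R v)
    = stack q p \<bullet> (onsager K C M *v stack q p)"
proof -
  \<comment> \<open>With \<open>i\<close> for the reciprocal the claim becomes a polynomial
    identity. The rewrites also hold at \<open>r = 0\<close>, where all these quotients are
    \<open>0\<close>.\<close>
  define i where "i = inverse r"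
  have i: "1 / r = i" "1 / r\<^sup>2 = i\<^sup>2" "m / r\<^sup>2 = m * i\<^sup>2" "m / r = m * i"
    by (simp_all add: i_def divide_inverse power_inverse)
  \<comment> \<open>Each off-diagonal block contributes
    \<open>- m * i ^ 4 * (u \<bullet> (C *v u))\<close>, which accounts for the factor
    \<open>2\<close> in the first flux.\<close>
  show ?thesis
    unfolding q_def p_def i onsager_quadratic_form
    by (simp add: matrix_vector_mult_diff_distrib matrix_vector_mult_scaleR
        linear_neg[OF matrix_vector_mul_linear] inner_diff_left inner_diff_right inner_add_left
        inner_commute algebra_simps power2_eq_square)
qed

lemma continuous_on_matrix_vector_mult:
  fixes A :: "'a::topological_space \<Rightarrow> real^'n^'m"
  assumes "continuous_on S A" "continuous_on S u"
  shows "continuous_on S (\<lambda>x. A x *v u x)"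
  unfolding matrix_vector_mult_def
  by (intro continuous_on_vec_lambda continuous_intros continuous_on_component assms)

text \<open>Splitting the integral of a sum requires integrability; the integrands concerned are all
  continuous.\<close>

lemma integrable_on_cube:
  fixes g :: "real^'d \<Rightarrow> real"
  assumes "continuous_on UNIV g"
  shows "g integrable_on cube a l"
  unfolding cube_def by (rule integrable_continuous[OF continuous_on_subset[OF assms]]) simp

text \<open>The core of the theorem, at a single time and with just the five named test functions;
  ellipticity enters as nonnegativity of the Onsager form.\<close>

lemma balance_laws_of_five_tests:
  fixes \<phi> \<mu> \<theta> :: "real \<Rightarrow> real^'d \<Rightarrow> real"
  assumes f: "smooth_on (UNIV \<times> {0<..}) (\<lambda>(p, r). f p r)"
    and coeffs: "\<And>A. A \<in> {K, C, M} \<Longrightarrow> Ck_on 1 (UNIV \<times> UNIV \<times> {0<..}) (\<lambda>(p, q, r). A p q r)"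
    and nonneg: "\<And>p q r \<zeta>. r > 0 \<Longrightarrow> 0 \<le> \<zeta> \<bullet> (onsager (K p q r) (C p q r) (M p q r) *v \<zeta>)"
    and reg: "regular l T \<phi> \<mu> \<theta>"
    and pos: "\<forall>t\<in>{0<..<T}. \<forall>x. \<theta> t x > 0"
    and t: "t \<in> {0<..<T}"
    and var: "variational (cube a l) \<gamma> f K C M \<phi> \<mu> \<theta> t {\<lambda>_. 1, \<mu> t} {dt \<phi> t} {\<lambda>_. 1, \<theta> t}"
  shows "balance_laws (cube a l) \<gamma> f K C M \<phi> \<mu> \<theta> t"
proof -
  note reg_facts = f reg pos t
  let ?K = "at_state K \<phi> \<theta> t" and ?C = "at_state C \<phi> \<theta> t" and ?M = "at_state M \<phi> \<theta> t"
  let ?\<Omega> = "cube a l"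
  let ?s = "dt (entropy \<gamma> f \<phi> \<theta>) t" and ?F = "\<lambda>x. d\<phi> f (\<phi> t x) (\<theta> t x)"
  let ?B = "dt (\<lambda>\<tau> x. d\<theta> f (\<phi> \<tau> x) (\<theta> \<tau> x)) t"
  \<comment> \<open>\<open>a1\<close> and \<open>b\<close> are the two fluxes of (V3). Moreover
    \<open>- b\<close> is the flux of (V1), which is what couples the two equations in the energy
    balance.\<close>
  define a1 where "a1 x = (1 / (\<theta> t x)\<^sup>2) *\<^sub>R (?K x *v grad (\<theta> t) x)
      + (1 / \<theta> t x) *\<^sub>R (?C x *v grad (\<mu> t) x)
      - (2 * (\<mu> t x / (\<theta> t x)\<^sup>2)) *\<^sub>R (?C x *v grad (\<theta> t) x)
      - (\<mu> t x / \<theta> t x) *\<^sub>R (?M x *v grad (\<mu> t) x)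
      + (\<mu> t x / \<theta> t x)\<^sup>2 *\<^sub>R (?M x *v grad (\<theta> t) x)" for x
  define b where "b x = (1 / (\<theta> t x)\<^sup>2) *\<^sub>R (?C x *v grad (\<theta> t) x)
      + (1 / \<theta> t x) *\<^sub>R (?M x *v grad (\<mu> t) x)
      - (\<mu> t x / (\<theta> t x)\<^sup>2) *\<^sub>R (?M x *v grad (\<theta> t) x)" for x
  have nz: "\<theta> t x \<noteq> 0" for x
    using pos t by (metis less_irrefl)
  have state: "continuous_on UNIV (at_state A \<phi> \<theta> t)" if "A \<in> {K, C, M}" for A
    by (rule continuous_at_state[OF reg_facts coeffs[OF that]])
  note tests = test_fns[OF reg_facts]
  note cont = continuous_\<phi>[OF reg_facts] continuous_grad_\<phi>[OF reg_facts]
    test_function_regularity(2,3)[OF tests(1)] test_function_regularity(2,3)[OF tests(2)]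
    test_function_regularity(2,3)[OF tests(3)]
    continuous_d\<phi>[OF reg_facts] continuous_dt_d\<theta>[OF reg_facts]
    state[of K, simplified] state[of C, simplified] state[of M, simplified]
  have cont_s: "continuous_on UNIV ?s"
    unfolding dt_entropy[OF reg_facts, abs_def] by (intro continuous_intros cont)
  have cont_a1: "continuous_on UNIV a1" and cont_b: "continuous_on UNIV b"
    unfolding a1_def[abs_def] b_def[abs_def]
    by (intro continuous_intros continuous_on_matrix_vector_mult cont; simp add: nz)+
  have V1: "ip ?\<Omega> (dt \<phi> t) \<psi> = - ip ?\<Omega> b (grad \<psi>)" if "\<psi> \<in> {\<lambda>_. 1, \<mu> t}" for \<psi>
  proof -
    have "ip ?\<Omega> (dt \<phi> t) \<psi> = ip ?\<Omega> (\<lambda>x. - b x) (grad \<psi>)"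
      using var that unfolding variational_def V1_def Let_def b_def[abs_def]
      by (auto simp: algebra_simps)
    then show ?thesis
      by (simp add: ip_def)
  qed
  have V2: "ip ?\<Omega> (\<mu> t) (dt \<phi> t) = \<gamma> * ip ?\<Omega> (grad (\<phi> t))
      (\<lambda>x. \<theta> t x *\<^sub>R grad (dt \<phi> t) x + dt \<phi> t x *\<^sub>R grad (\<theta> t) x) + ip ?\<Omega> ?F (dt \<phi> t)"
    using var unfolding variational_def V2_def by blast
  have V3: "ip ?\<Omega> ?s \<omega> =
      ip ?\<Omega> a1 (\<lambda>x. (\<omega> x / (\<theta> t x)\<^sup>2) *\<^sub>R grad (\<theta> t) x - (1 / \<theta> t x) *\<^sub>R grad \<omega> x)
      + ip ?\<Omega> b (\<lambda>x. (\<omega> x / \<theta> t x) *\<^sub>R grad (\<mu> t) x)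
      + \<gamma> * ip ?\<Omega> (\<lambda>x. dt \<phi> t x *\<^sub>R grad (\<phi> t) x) (grad \<omega>)" if "\<omega> \<in> {\<lambda>_. 1, \<theta> t}" for \<omega>
    using var that unfolding variational_def V3_def Let_def a1_def[abs_def] b_def[abs_def] by blast

  have mass: "ip ?\<Omega> (dt \<phi> t) (\<lambda>_. 1) = 0"
    using V1[of "\<lambda>_. 1"] by (simp add: ip_def grad_const)

  let ?L = "\<lambda>x. onsager (?K x) (?C x) (?M x)"
  let ?D = "dissipation ?\<Omega> ?L (\<lambda>x. \<mu> t x / \<theta> t x) (\<lambda>x. 1 / \<theta> t x)"
  have "ip ?\<Omega> ?s (\<lambda>_. 1) = ip ?\<Omega> a1 (\<lambda>x. (1 / (\<theta> t x)\<^sup>2) *\<^sub>R grad (\<theta> t) x)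
      + ip ?\<Omega> b (\<lambda>x. (1 / \<theta> t x) *\<^sub>R grad (\<mu> t) x)"
    using V3[of "\<lambda>_. 1"] by (simp add: ip_def grad_const)
  \<comment> \<open>Joining the integrals makes the pointwise identity
    \<open>entropy_production\<close> applicable; the quotient rules then identify its vectors with
    the gradients in the dissipation.\<close>
  also have "\<dots> = integral ?\<Omega> (\<lambda>x. a1 x \<bullet> ((1 / (\<theta> t x)\<^sup>2) *\<^sub>R grad (\<theta> t) x)
      + b x \<bullet> ((1 / \<theta> t x) *\<^sub>R grad (\<mu> t) x))"
    unfolding ip_def
    by (rule integral_add[symmetric];
        intro integrable_on_cube continuous_intros cont cont_a1 cont_b; simp add: nz)
  also have "\<dots> = ?D"
    unfolding dissipation_def a1_def b_def entropy_production
    by (simp only: grad_reciprocal grad_divide test_function_regularity(1)[OF tests(1)]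
        test_function_regularity(1)[OF tests(3)] nz not_False_eq_True)
  finally have production: "ip ?\<Omega> ?s (\<lambda>_. 1) = ?D" .
  have "?D \<ge> 0"
  proof -
    have "0 \<le> \<zeta> \<bullet> (?L x *v \<zeta>)" for x \<zeta>
      unfolding at_state_def using nonneg pos t by blast
    \<comment> \<open>If the integrand were not integrable, its integral would be \<open>0\<close>
      by convention, so the bound holds in either case.\<close>
    then show ?thesis
      unfolding dissipation_def
      by (cases "(\<lambda>x. stack (grad (\<lambda>x. 1 / \<theta> t x) x) (grad (\<lambda>x. \<mu> t x / \<theta> t x) x) \<bullet>
          (?L x *v stack (grad (\<lambda>x. 1 / \<theta> t x) x) (grad (\<lambda>x. \<mu> t x / \<theta> t x) x))) integrable_on ?\<Omega>")
        (auto intro: integral_nonneg simp: not_integrable_integral)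
  qed

  \<comment> \<open>These are the two parts of the gradient term in (V2) for
    \<open>\<xi> = dt \<phi> t\<close>. \<open>?Y\<close> returns in (V3) for
    \<open>\<omega> = \<theta> t\<close>, and \<open>?X\<close> in the energy rate through
    \<open>dt_entropy\<close>.\<close>
  let ?X = "\<lambda>x. \<theta> t x * (grad (\<phi> t) x \<bullet> grad (dt \<phi> t) x)"
  let ?Y = "\<lambda>x. dt \<phi> t x * (grad (\<phi> t) x \<bullet> grad (\<theta> t) x)"
  have int: "?X integrable_on ?\<Omega>" "?Y integrable_on ?\<Omega>"
    "(\<lambda>x. ?F x * dt \<phi> t x) integrable_on ?\<Omega>" "(\<lambda>x. ?s x * \<theta> t x) integrable_on ?\<Omega>"
    by (intro integrable_on_cube continuous_intros cont cont_s)+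
  \<comment> \<open>For \<open>\<omega> = \<theta> t\<close> both coefficients equal
    \<open>1 / \<theta> t x\<close>, so the vector paired with \<open>a1\<close> vanishes
    pointwise.\<close>
  have "ip ?\<Omega> a1 (\<lambda>x. (\<theta> t x / (\<theta> t x)\<^sup>2) *\<^sub>R grad (\<theta> t) x - (1 / \<theta> t x) *\<^sub>R grad (\<theta> t) x) = 0"
    by (simp add: ip_def power2_eq_square nz)
  then have heat: "ip ?\<Omega> ?s (\<theta> t) = ip ?\<Omega> b (grad (\<mu> t)) + \<gamma> * integral ?\<Omega> ?Y"
    using V3[of "\<theta> t"] by (simp add: nz ip_def)
  have diffusion: "ip ?\<Omega> (\<mu> t) (dt \<phi> t) = - ip ?\<Omega> b (grad (\<mu> t))"
    using V1[of "\<mu> t"] by (simp add: ip_def mult.commute)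
  have "ip ?\<Omega> (grad (\<phi> t)) (\<lambda>x. \<theta> t x *\<^sub>R grad (dt \<phi> t) x + dt \<phi> t x *\<^sub>R grad (\<theta> t) x) =
      integral ?\<Omega> ?X + integral ?\<Omega> ?Y"
    unfolding ip_def inner_add_right inner_scaleR_right by (rule integral_add[OF int(1,2)])
  with V2 have potential: "ip ?\<Omega> (\<mu> t) (dt \<phi> t) =
      \<gamma> * (integral ?\<Omega> ?X + integral ?\<Omega> ?Y) + ip ?\<Omega> ?F (dt \<phi> t)"
    by simp
  \<comment> \<open>The time derivative of \<open>d\<theta> f\<close> is eliminated between
    \<open>dt_energy\<close> and \<open>dt_entropy\<close>.\<close>
  have "dt (energy f \<phi> \<theta>) t x = ?F x * dt \<phi> t x + ?s x * \<theta> t x + \<gamma> * ?X x" for x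
    unfolding dt_energy[OF reg_facts] dt_entropy[OF reg_facts] by (simp add: algebra_simps)
  then have "ip ?\<Omega> (dt (energy f \<phi> \<theta>) t) (\<lambda>_. 1) =
      integral ?\<Omega> (\<lambda>x. ?F x * dt \<phi> t x + ?s x * \<theta> t x + \<gamma> * ?X x)"
    by (simp add: ip_def)
  also have "\<dots> = ip ?\<Omega> ?F (dt \<phi> t) + ip ?\<Omega> ?s (\<theta> t) + \<gamma> * integral ?\<Omega> ?X"
    using int unfolding ip_def inner_real_def
    by (intro integral_unique has_integral_add has_integral_mult_right integrable_integral)
  \<comment> \<open>\<open>heat\<close> replaces the entropy term, \<open>potential\<close> gathers
    everything except \<open>ip ?\<Omega> b (grad (\<mu> t))\<close> into
    \<open>ip ?\<Omega> (\<mu> t) (dt \<phi> t)\<close>, and \<open>diffusion\<close> says that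
    these two cancel.\<close>
  also have "\<dots> = 0"
    using heat diffusion potential by (simp add: algebra_simps)
  finally have "ip ?\<Omega> (dt (energy f \<phi> \<theta>) t) (\<lambda>_. 1) = 0" .
  with mass production \<open>?D \<ge> 0\<close> show ?thesis
    unfolding balance_laws_def Let_def by blast
qed

theorem theorem4:
  fixes a :: "real^'d" and l T \<gamma> lam0 lam1 :: real
    and f :: "real \<Rightarrow> real \<Rightarrow> real"
    and K C M :: "'d coeff"
    and \<phi> \<mu> \<theta> :: "real \<Rightarrow> real^'d \<Rightarrow> real"
  assumes dim: "CARD('d) \<in> {1, 2, 3}"
    and "l > 0" and "T > 0" and "\<gamma> > 0"
    and f: "smooth_on (UNIV \<times> {0<..}) (\<lambda>(p, r). f p r)"
    and coeffs: "\<And>A. A \<in> {K, C, M} \<Longrightarrow> Ck_on 1 (UNIV \<times> UNIV \<times> {0<..}) (\<lambda>(p, q, r). A p q r)"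
    and "lam0 > 0" and "lam1 > 0"
    and bounds: "\<And>p q r \<zeta>. r > 0 \<Longrightarrow>
          lam0 * (norm \<zeta>)\<^sup>2 \<le> \<zeta> \<bullet> (onsager (K p q r) (C p q r) (M p q r) *v \<zeta>) \<and>
          \<zeta> \<bullet> (onsager (K p q r) (C p q r) (M p q r) *v \<zeta>) \<le> lam1 * (norm \<zeta>)\<^sup>2"
    and reg: "regular l T \<phi> \<mu> \<theta>"
    and pos: "\<And>t x. t \<in> {0<..<T} \<Longrightarrow> \<theta> t x > 0"
  shows "((\<forall>t\<in>{0<..<T}. variational (cube a l) \<gamma> f K C M \<phi> \<mu> \<theta> t
             (test_functions l) (test_functions l) (test_functions l)) \<longrightarrow>
           (\<forall>t\<in>{0<..<T}. balance_laws (cube a l) \<gamma> f K C M \<phi> \<mu> \<theta> t)) \<and>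
         (\<forall>t\<in>{0<..<T}. variational (cube a l) \<gamma> f K C M \<phi> \<mu> \<theta> t
             {\<lambda>_. 1, \<mu> t} {dt \<phi> t} {\<lambda>_. 1, \<theta> t} \<longrightarrow>
           balance_laws (cube a l) \<gamma> f K C M \<phi> \<mu> \<theta> t)"
proof -
  have tested: "balance_laws (cube a l) \<gamma> f K C M \<phi> \<mu> \<theta> t"
    if t: "t \<in> {0<..<T}"
      and var: "variational (cube a l) \<gamma> f K C M \<phi> \<mu> \<theta> t {\<lambda>_. 1, \<mu> t} {dt \<phi> t} {\<lambda>_. 1, \<theta> t}" for t
  proof (rule balance_laws_of_five_tests[OF f _ _ reg _ t var])
    show "Ck_on 1 (UNIV \<times> UNIV \<times> {0<..}) (\<lambda>(p, q, r). A p q r)" if "A \<in> {K, C, M}" for A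
      by (rule coeffs[OF that])
    show "0 \<le> \<zeta> \<bullet> (onsager (K p q r) (C p q r) (M p q r) *v \<zeta>)" if "r > 0" for p q r \<zeta>
    proof -
      have "0 \<le> lam0 * (norm \<zeta>)\<^sup>2"
        using \<open>lam0 > 0\<close> by simp
      also have "\<dots> \<le> \<zeta> \<bullet> (onsager (K p q r) (C p q r) (M p q r) *v \<zeta>)"
        using bounds[OF that] by blast
      finally show ?thesis .
    qed
    show "\<forall>t\<in>{0<..<T}. \<forall>x. \<theta> t x > 0"
      using pos by blast
  qed
  \<comment> \<open>The five functions are admissible: \<open>1\<close> as a constant, the others by
    \<open>regular\<close>. So the full formulation implies the reduced one.\<close>
  moreover have "variational (cube a l) \<gamma> f K C M \<phi> \<mu> \<theta> t {\<lambda>_. 1, \<mu> t} {dt \<phi> t} {\<lambda>_. 1, \<theta> t}"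
    if "t \<in> {0<..<T}" "variational (cube a l) \<gamma> f K C M \<phi> \<mu> \<theta> t
      (test_functions l) (test_functions l) (test_functions l)" for t
    using that reg const_test_function[of 1 l] unfolding variational_def regular_def by blast
  ultimately show ?thesis
    by blast
qed

end
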